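(* Let $\omega>0$ and let $\{\alpha_k\}_{k\ge1}$, $\{\delta_k\}_{k\ge1}$, $\{\omega_k\}_{k\ge1}$ be real sequences with $\alpha_1=1$, $0<\alpha_k<1$ for $k\ge2$, $\delta_k>0$, $\omega_k>0$. Put $\Gamma_1=1$ and $\Gamma_k=(1-\alpha_k)\Gamma_{k-1}$ for $k\ge2$. Assume that for every $N$ $$\alpha_k\delta_k\le\omega_k<\frac1{L_\Psi}\quad (k=1,\dots,N),\qquad \frac{\alpha_1}{\delta_1\Gamma_1}\ge\frac{\alpha_2}{\delta_2\Gamma_2}\ge\cdots\ge\frac{\alpha_N}{\delta_N\Gamma_N},$$ that $\delta_1=\omega_k=\omega$ for all $k$, and that $h=0$ (so that $L_h=0$). Then the complexity upper bound $$B_N=\left[\sum_{k=1}^{N}\Gamma_k^{-1}\omega_k\left(1-L_\Psi\omega_k\right)\right]^{-1}\left[\frac{\|x_0-x^*\|^2}{\delta_1}+\frac{2L_h}{\Gamma_N}\left(\|x^*\|^2+M^2\right)\right]$$ satisfies $B_N=O(1/N)$ as $N\to\infty$.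
   Context: The setting is the composite problem $\min_{x\in\mathbb{R}^{q+1}}\Psi(x)+\chi(x)$, $\Psi=f+h$, where $f$ is convex with $L_f$-Lipschitz gradient, $h$ is possibly nonconvex with $L_h$-Lipschitz gradient, and $\chi$ is convex over a bounded domain; $L_\Psi>0$ is the Lipschitz constant of $\nabla\Psi$. It is treated by the accelerated gradient algorithm with hyperparameters $\{\alpha_k\},\{\delta_k\},\{\omega_k\}$: $x_0^{ag}=x_0$, $x_k^{md}=\alpha_kx_{k-1}^{ag}+(1-\alpha_k)x_{k-1}$, $x_k=\mathcal{P}(x_{k-1},\nabla\Psi(x_k^{md}),\delta_k)$, $x_k^{ag}=\mathcal{P}(x_k^{md},\nabla\Psi(x_k^{md}),\omega_k)$, where $\mathcal{P}(x,y,c)=\arg\min_u\{\langle y,u\rangle+\frac1{2c}\|u-x\|^2+\chi(u)\}$. The quantity $B_N$ is a known upper bound for $\min_{k=1,\dots,N}\|\mathcal{G}(x_k^{md},\nabla\Psi(x_k^{md}),\omega_k)\|^2$, where $\mathcal{G}(x,y,c)=\frac1c[x-\mathcal{P}(x,y,c)]$. Here $x_0$ (starting point), $x^*$ (a minimizer) and $M$ are fixed and do not depend on $N$; only the formula for $B_N$ matters for the statement. *)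

theory Defs
  imports "HOL-Analysis.Analysis" "HOL-Library.Landau_Symbols"
begin

definition lipschitz_gradient :: "real \<Rightarrow> ('a::real_inner \<Rightarrow> real) \<Rightarrow> bool" where
  "lipschitz_gradient L f \<longleftrightarrow>
     (\<exists>g. (\<forall>x. GDERIV f x :> g x) \<and> L-lipschitz_on UNIV g)"

(* The extended-valued convex function chi is given by its effective domain X, on which it is
   real-valued; its values outside X are irrelevant.  LP is any Lipschitz constant of the gradient
   of f + h, not necessarily the least one or Lf + Lh. *)
definition composite_problem ::
  "real \<Rightarrow> real \<Rightarrow> real \<Rightarrow> ('a::real_inner \<Rightarrow> real) \<Rightarrow> ('a \<Rightarrow> real) \<Rightarrow> 'a set \<Rightarrow> ('a \<Rightarrow> real) \<Rightarrow> bool"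
where
  "composite_problem Lf Lh LP f h X chi \<longleftrightarrow>
     convex_on UNIV f \<and> lipschitz_gradient Lf f \<and>
     lipschitz_gradient Lh h \<and>
     LP > 0 \<and> lipschitz_gradient LP (\<lambda>x. f x + h x) \<and>
     bounded X \<and> convex_on X chi"

(* Indices start at 1; the value at 0 is a dummy. *)
primrec Gam :: "(nat \<Rightarrow> real) \<Rightarrow> nat \<Rightarrow> real" where
  "Gam \<alpha> 0 = 1"
| "Gam \<alpha> (Suc k) = (if k = 0 then 1 else (1 - \<alpha> (Suc k)) * Gam \<alpha> k)"

definition complexity_bound ::
  "real \<Rightarrow> real \<Rightarrow> (nat \<Rightarrow> real) \<Rightarrow> (nat \<Rightarrow> real) \<Rightarrow> (nat \<Rightarrow> real) \<Rightarrow>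
   'a::real_inner \<Rightarrow> 'a \<Rightarrow> real \<Rightarrow> nat \<Rightarrow> real" where
  "complexity_bound LP Lh \<alpha> \<delta> w x0 xstar M N =
     inverse (\<Sum>k=1..N. inverse (Gam \<alpha> k) * w k * (1 - LP * w k)) *
     ((norm (x0 - xstar))\<^sup>2 / \<delta> 1 + 2 * Lh / Gam \<alpha> N * ((norm xstar)\<^sup>2 + M\<^sup>2))"

end

theory Submission
  imports Defs
begin

text \<open>With the constant step \<omega>, each summand in the denominator of the bound is
  \<open>inverse (Gam \<alpha> k)\<close> times the same number
  \<open>c = \<omega> * (1 - LP * \<omega>)\<close>, which is positive because \<omega> < 1 /
  \<open>LP\<close>. By \<open>Gam_pos_le_1\<close> the weight
  \<open>inverse (Gam \<alpha> k)\<close> is at least 1, so the sum is at least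
  \<open>N * c\<close>. For \<open>Lh = 0\<close> the numerator is a constant \<open>D\<close>, and
  the bound is at most \<open>(D / c) / N\<close>.\<close>

lemma Gam_pos_le_1:
  assumes "\<forall>k\<ge>2. 0 < \<alpha> k \<and> \<alpha> k < 1"
  shows "0 < Gam \<alpha> k \<and> Gam \<alpha> k \<le> 1"
proof (induction k)
  case (Suc k)
  show ?case
  \<comment> \<open>\<open>Gam\<close> is 1 at both 0 and 1; the factor
    \<open>1 - \<alpha> (Suc k)\<close> enters only from index 2 on, exactly where it is known to
    lie in (0,1).\<close>
  proof (cases "k = 0")
    case False
    then have "0 < \<alpha> (Suc k)" "\<alpha> (Suc k) < 1"
      using assms by auto
    then show ?thesis
      using Suc by (auto intro!: mult_le_one)
  qed simp
qed simp

theorem theorem2: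
  fixes f h chi :: "real ^ 'n \<Rightarrow> real" and X :: "(real ^ 'n) set"
    and x0 xstar :: "real ^ 'n"
    and Lf Lh LP M \<omega> :: real
    and \<alpha> \<delta> w :: "nat \<Rightarrow> real"
  assumes problem: "composite_problem Lf Lh LP f h X chi"
    and minimizer: "is_arg_min (\<lambda>x. f x + h x + chi x) (\<lambda>x. x \<in> X) xstar"
    and omega_pos: "\<omega> > 0"
    and alpha_1: "\<alpha> 1 = 1"
    and alpha_range: "\<forall>k\<ge>2. 0 < \<alpha> k \<and> \<alpha> k < 1"
    and delta_pos: "\<forall>k\<ge>1. \<delta> k > 0"
    and w_pos: "\<forall>k\<ge>1. w k > 0"
    and step_sizes: "\<forall>N\<ge>1. (\<forall>k\<in>{1..N}. \<alpha> k * \<delta> k \<le> w k \<and> w k < 1 / LP) \<and>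
      (\<forall>k\<in>{1..<N}. \<alpha> k / (\<delta> k * Gam \<alpha> k) \<ge> \<alpha> (k + 1) / (\<delta> (k + 1) * Gam \<alpha> (k + 1)))"
    and delta_1: "\<delta> 1 = \<omega>"
    and w_const: "\<forall>k\<ge>1. w k = \<omega>"
    and h_zero: "h = (\<lambda>x. 0)"
    and Lh_zero: "Lh = 0"
  shows "(\<lambda>N. complexity_bound LP Lh \<alpha> \<delta> w x0 xstar M N) \<in> O(\<lambda>N. 1 / real N)"
proof -
  define c where "c = \<omega> * (1 - LP * \<omega>)"
  define D where "D = (norm (x0 - xstar))\<^sup>2 / \<omega>"
  have "LP > 0"
    using problem by (simp add: composite_problem_def)
  \<comment> \<open>A single index suffices, for instance N = k = 1, since all \<open>w k\<close>
    equal \<omega>.\<close>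
  moreover have "\<omega> < 1 / LP"
    using step_sizes w_const by fastforce
  ultimately have "LP * \<omega> < 1"
    by (simp add: field_simps)
  then have "c > 0"
    using omega_pos by (simp add: c_def)
  have "D \<ge> 0"
    using omega_pos by (simp add: D_def)
  have "norm (complexity_bound LP Lh \<alpha> \<delta> w x0 xstar M N) \<le> D / c * norm (1 / real N)"
    if "N \<ge> 1" for N
  proof -
    define S where "S = (\<Sum>k=1..N. inverse (Gam \<alpha> k) * w k * (1 - LP * w k))"
    have "real N * c = (\<Sum>k=1..N. c)"
      by simp
    also have "\<dots> \<le> S"
      unfolding S_def
    proof (rule sum_mono)
      fix k assume "k \<in> {1..N}"
      then have "w k = \<omega>"
        using w_const by simp
      moreover have "1 \<le> inverse (Gam \<alpha> k)"
        \<comment> \<open>Replacing the weight by 1 leaves the k-independent lower bound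
          \<open>c\<close>.\<close>
        using Gam_pos_le_1[OF alpha_range] by (simp add: one_le_inverse)
      ultimately show "c \<le> inverse (Gam \<alpha> k) * w k * (1 - LP * w k)"
        using mult_right_mono[of 1 "inverse (Gam \<alpha> k)" c] \<open>c > 0\<close>
        by (simp add: c_def mult.assoc)
    qed
    finally have "real N * c \<le> S" .
    \<comment> \<open>Inversion reverses the inequality because the smaller side is positive; this
      is where N \<ge> 1 enters.\<close>
    moreover have "0 < real N * c"
      using that \<open>c > 0\<close> by simp
    ultimately have "0 < S" "inverse S \<le> inverse (real N * c)"
      by (linarith, intro le_imp_inverse_le)
    \<comment> \<open>\<open>Lh = 0\<close> removes the term divided by
      \<open>Gam \<alpha> N\<close>, the only part of the numerator that depends on N.\<close>
    moreover have "complexity_bound LP Lh \<alpha> \<delta> w x0 xstar M N = inverse S * D"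
      by (simp add: complexity_bound_def S_def D_def delta_1[simplified] Lh_zero)
    ultimately show ?thesis
      using \<open>D \<ge> 0\<close> mult_right_mono[of "inverse S" "inverse (real N * c)" D]
      by (simp add: abs_mult divide_inverse mult.commute mult.left_commute)
  qed
  then show ?thesis
    by (intro bigoI[where c = "D / c"]) (auto simp: eventually_at_top_linorder)
qed

end
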